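(* Let $S:\mathbb{R}^n\times\mathbb{R}^m\to\mathbb{R}$ be strictly convex-concave and continuously differentiable, and suppose that $S$ has at least one saddle point. Let $(x_\star,y_\star)$ be an arbitrary saddle point of $S$. Then the function $$h(x,y):=\begin{bmatrix} S(x_\star,y_\star)-S(x_\star,y)\\ S(x,y_\star)-S(x_\star,y_\star)\end{bmatrix}$$ is an observable certificate of $S$.
   Context: Inequalities between vectors are entrywise. $\nabla_x S,\nabla_y S$ denote the (column) partial gradients. Convex-concave: $S(\cdot,y)$ is convex for every $y\in\mathbb{R}^m$ and $S(x,\cdot)$ is concave for every $x\in\mathbb{R}^n$. Strictly convex-concave: $S$ is convex-concave and either $S(\cdot,y)$ is strictly convex for every $y\in\mathbb{R}^m$, or $S(x,\cdot)$ is strictly concave for every $x\in\mathbb{R}^n$. Saddle point of $S$: a point $(x_\star,y_\star)\in\mathbb{R}^n\times\mathbb{R}^m$ such that $S(x_\star,y)\le S(x_\star,y_\star)\le S(x,y_\star)$ for all $x\in\mathbb{R}^n$ and all $y\in\mathbb{R}^m$. Observable certificate: a function $h:\mathbb{R}^n\times\mathbb{R}^m\to\mathbb{R}^2_{\ge 0}$ is an observable certificate of $S$ if and only if (i) there exists a saddle point $(x_\star,y_\star)$ of $S$ such that for all $(x,y)$ $$\begin{bmatrix} S(x_\star,y_\star)-S(x_\star,y)\\ S(x,y_\star)-S(x_\star,y_\star)\end{bmatrix}\ge h(x,y)\ge 0,$$ and (ii) for any trajectory $(x(t),y(t))$ of the saddle flow dynamics $\dot x=-\nabla_xS(x,y)$,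 $\dot y=+\nabla_yS(x,y)$ that satisfies $h(x(t),y(t))\equiv 0$, we have $\dot x\equiv 0$ and $\dot y\equiv 0$. *)

theory Defs
  imports "HOL-Analysis.Analysis"
begin

definition strictly_convex_on :: "'a::real_vector set \<Rightarrow> ('a \<Rightarrow> real) \<Rightarrow> bool" where
  "strictly_convex_on A f \<longleftrightarrow> convex A \<and>
     (\<forall>x\<in>A. \<forall>y\<in>A. \<forall>u>0. \<forall>v>0. x \<noteq> y \<longrightarrow> u + v = 1 \<longrightarrow>
        f (u *\<^sub>R x + v *\<^sub>R y) < u * f x + v * f y)"

definition strictly_concave_on :: "'a::real_vector set \<Rightarrow> ('a \<Rightarrow> real) \<Rightarrow> bool" where
  "strictly_concave_on A f \<longleftrightarrow> strictly_convex_on A (\<lambda>x. - f x)"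

definition convex_concave :: "('a::real_vector \<times> 'b::real_vector \<Rightarrow> real) \<Rightarrow> bool" where
  "convex_concave S \<longleftrightarrow>
     (\<forall>y. convex_on UNIV (\<lambda>x. S (x, y))) \<and> (\<forall>x. concave_on UNIV (\<lambda>y. S (x, y)))"

definition strictly_convex_concave :: "('a::real_vector \<times> 'b::real_vector \<Rightarrow> real) \<Rightarrow> bool" where
  "strictly_convex_concave S \<longleftrightarrow> convex_concave S \<and>
     ((\<forall>y. strictly_convex_on UNIV (\<lambda>x. S (x, y))) \<or>
      (\<forall>x. strictly_concave_on UNIV (\<lambda>y. S (x, y))))"

definition continuously_differentiable :: "('a::euclidean_space \<Rightarrow> real) \<Rightarrow> bool" where
  "continuously_differentiable f \<longleftrightarrow>
     (\<exists>G. (\<forall>z. GDERIV f z :> G z) \<and> continuous_on UNIV G)"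

(* Unspecified where f is not differentiable. *)
definition gradient :: "('a::euclidean_space \<Rightarrow> real) \<Rightarrow> 'a \<Rightarrow> 'a" where
  "gradient f x = (THE D. GDERIV f x :> D)"

definition saddle_point :: "('a \<times> 'b \<Rightarrow> real) \<Rightarrow> 'a \<Rightarrow> 'b \<Rightarrow> bool" where
  "saddle_point S xs ys \<longleftrightarrow>
     (\<forall>x y. S (xs, y) \<le> S (xs, ys) \<and> S (xs, ys) \<le> S (x, ys))"

(* Time runs over [0,\<infinity>); the derivative at t = 0 is one-sided. *)
definition saddle_flow_trajectory ::
    "('a::euclidean_space \<times> 'b::euclidean_space \<Rightarrow> real) \<Rightarrow> (real \<Rightarrow> 'a) \<Rightarrow> (real \<Rightarrow> 'b) \<Rightarrow> bool" where
  "saddle_flow_trajectory S x y \<longleftrightarrow>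
     (\<forall>t\<ge>0.
        (x has_vector_derivative - gradient (\<lambda>u. S (u, y t)) (x t)) (at t within {0..}) \<and>
        (y has_vector_derivative gradient (\<lambda>v. S (x t, v)) (y t)) (at t within {0..}))"

(* The order on real ^ 2 is entrywise. *)
definition observable_certificate ::
    "('a::euclidean_space \<times> 'b::euclidean_space \<Rightarrow> real) \<Rightarrow> ('a \<times> 'b \<Rightarrow> real ^ 2) \<Rightarrow> bool" where
  "observable_certificate S h \<longleftrightarrow>
     (\<exists>xs ys. saddle_point S xs ys \<and>
        (\<forall>x y. vector [S (xs, ys) - S (xs, y), S (x, ys) - S (xs, ys)] \<ge> h (x, y) \<and>
               h (x, y) \<ge> 0)) \<and>
     (\<forall>x y. saddle_flow_trajectory S x y \<longrightarrow> (\<forall>t\<ge>0. h (x t, y t) = 0) \<longrightarrow>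
        (\<forall>t\<ge>0. (x has_vector_derivative 0) (at t within {0..}) \<and>
               (y has_vector_derivative 0) (at t within {0..})))"

end

theory Submission
  imports Defs
begin

text \<open>
  Where the certificate vanishes along a trajectory, \<open>x(t)\<close> minimises \<open>S(\<sqdot>, y\<^sub>\<star>)\<close> and \<open>y(t)\<close> maximises
  \<open>S(x\<^sub>\<star>, \<sqdot>)\<close>. The strict side has a unique optimiser, so that component of the trajectory is
  constantly equal to the corresponding component of the saddle point; the other component then
  moves along the gradient of a function at one of its optimisers, which is zero.
\<close>

text \<open>\<open>gradient\<close> is a definite description, so uniqueness is what lets
  \<open>gradient_eq\<close> replace it by any known derivative.\<close>

lemma GDERIV_unique:
  assumes "GDERIV f x :> D" "GDERIV f x :> E"
  shows "D = E"
proof -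
  have "(\<lambda>h. inner h D) = (\<lambda>h. inner h E)"
    using assms unfolding gderiv_def by (rule has_derivative_unique)
  then show ?thesis
    by (metis inner_commute vector_eq_rdot)
qed

lemma gradient_eq:
  assumes "GDERIV f x :> D"
  shows "gradient f x = D"
  unfolding gradient_def using assms GDERIV_unique by blast

lemma GDERIV_global_min:
  assumes "GDERIV f x :> D" "\<And>u. f x \<le> f u"
  shows "D = 0"
proof -
  have "(\<lambda>h. inner h D) = (\<lambda>h. 0)"
    using assms unfolding gderiv_def
    by (intro differential_zero_maxmin[of x UNIV f]) auto
  \<comment> \<open>Evaluating both functionals at \<open>D\<close> gives
    \<open>inner D D = 0\<close>.\<close>
  then show ?thesis
    by (metis inner_eq_zero_iff)
qed

lemma GDERIV_global_max:
  assumes "GDERIV f x :> D" "\<And>u. f u \<le> f x"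
  shows "D = 0"
proof -
  have "GDERIV (\<lambda>u. - f u) x :> - D"
    using assms(1) by (rule GDERIV_minus)
  then have "- D = 0"
    using assms(2) by (intro GDERIV_global_min[of "\<lambda>u. - f u" x]) auto
  then show ?thesis by simp
qed

text \<open>Chain rule along the embedding of a slice: its derivative sends \<open>h\<close> to
  \<open>(h, 0)\<close>, and \<open>inner (h, 0) G\<close> equals
  \<open>inner h (fst G)\<close>.\<close>

lemma GDERIV_partial_fst:
  assumes "GDERIV S (x, y) :> G"
  shows "GDERIV (\<lambda>u. S (u, y)) x :> fst G"
proof -
  have "((\<lambda>u. S (u, y)) has_derivative (\<lambda>h. inner (h, 0) G)) (at x)"
    using has_derivative_compose[OF has_derivative_Pair[OF has_derivative_ident has_derivative_const]]
      assms unfolding gderiv_def by blast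
  then show ?thesis
    unfolding gderiv_def by (simp add: inner_prod_def)
qed

lemma GDERIV_partial_snd:
  assumes "GDERIV S (x, y) :> G"
  shows "GDERIV (\<lambda>v. S (x, v)) y :> snd G"
proof -
  have "((\<lambda>v. S (x, v)) has_derivative (\<lambda>h. inner (0, h) G)) (at y)"
    using has_derivative_compose[OF has_derivative_Pair[OF has_derivative_const has_derivative_ident]]
      assms unfolding gderiv_def by blast
  then show ?thesis
    unfolding gderiv_def by (simp add: inner_prod_def)
qed

text \<open>At the midpoint of two distinct minimisers, strict convexity would force a value below
  the minimum.\<close>

lemma strictly_convex_on_min_unique:
  assumes "strictly_convex_on A f" "a \<in> A" "b \<in> A"
    and "\<And>u. u \<in> A \<Longrightarrow> f a \<le> f u" "f b = f a"
  shows "b = a"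
proof (rule ccontr)
  assume "b \<noteq> a"
  let ?m = "(1/2) *\<^sub>R b + (1/2) *\<^sub>R a"
  have "convex A"
    and strict: "\<And>x y u v. \<lbrakk>x \<in> A; y \<in> A; u > 0; v > 0; x \<noteq> y; u + v = 1\<rbrakk> \<Longrightarrow>
      f (u *\<^sub>R x + v *\<^sub>R y) < u * f x + v * f y"
    using assms(1) unfolding strictly_convex_on_def by blast+
  have "f ?m < 1/2 * f b + 1/2 * f a"
    by (rule strict) (use assms(2,3) \<open>b \<noteq> a\<close> in auto)
  moreover have "?m \<in> A"
    by (rule convexD) (use \<open>convex A\<close> assms(2,3) in auto)
  ultimately show False
    using assms(4)[of ?m] assms(5) by simp
qed

text \<open>Nothing is known about \<open>f\<close> outside \<open>T\<close>, later the half-line of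
  nonnegative times; the derivative within \<open>T\<close> does not see those values.\<close>

lemma has_vector_derivative_zero_of_constant:
  assumes "\<And>t. t \<in> T \<Longrightarrow> f t = c" "t \<in> T"
  shows "(f has_vector_derivative 0) (at t within T)"
  by (rule has_vector_derivative_transform[OF assms(2,1) has_vector_derivative_const])

lemma vector_2_eq_zero_iff:
  fixes a b :: real
  shows "(vector [a, b] :: real ^ 2) = 0 \<longleftrightarrow> a = 0 \<and> b = 0"
  by (simp add: vec_eq_iff forall_2)

theorem proposition2:
  fixes S :: "(real ^ 'n) \<times> (real ^ 'm) \<Rightarrow> real"
    and xs :: "real ^ 'n" and ys :: "real ^ 'm"
  assumes "strictly_convex_concave S"
    and "continuously_differentiable S"
    and "saddle_point S xs ys"
  shows "observable_certificate S
           (\<lambda>(x, y). vector [S (xs, ys) - S (xs, y), S (x, ys) - S (xs, ys)])"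
proof -
  have saddle: "S (xs, v) \<le> S (xs, ys)" "S (xs, ys) \<le> S (u, ys)" for u v
    using assms(3) unfolding saddle_point_def by auto
  obtain G where G: "GDERIV S z :> G z" for z
    using assms(2) unfolding continuously_differentiable_def by blast
  \<comment> \<open>\<open>zero\<close> is assumed at all nonnegative times, not only at
    \<open>t\<close>: the component on the strict side has derivative 0 because it is constant on
    the whole half-line.\<close>
  have stationary: "(x has_vector_derivative 0) (at t within {0..}) \<and>
      (y has_vector_derivative 0) (at t within {0..})"
    if flow: "saddle_flow_trajectory S x y" and "t \<ge> 0"
      and zero: "\<And>t. t \<ge> 0 \<Longrightarrow> S (xs, y t) = S (xs, ys) \<and> S (x t, ys) = S (xs, ys)"
    for x y t
  proof -
    have dx: "(x has_vector_derivative - gradient (\<lambda>u. S (u, y t)) (x t)) (at t within {0..})"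
      and dy: "(y has_vector_derivative gradient (\<lambda>v. S (x t, v)) (y t)) (at t within {0..})"
      using flow \<open>t \<ge> 0\<close> unfolding saddle_flow_trajectory_def by auto
    consider "\<And>v. strictly_convex_on UNIV (\<lambda>u. S (u, v))"
      | "\<And>u. strictly_concave_on UNIV (\<lambda>v. S (u, v))"
      using assms(1) unfolding strictly_convex_concave_def by blast
    then show ?thesis
    proof cases
      case 1
      have const: "x s = xs" if "s \<ge> 0" for s
        using strictly_convex_on_min_unique[OF 1[of ys], of xs "x s"] saddle(2) zero[OF that]
        by auto
      \<comment> \<open>The slice is taken at \<open>xs\<close>, where \<open>zero\<close> makes
        \<open>y t\<close> a maximiser; \<open>const\<close> identifies it with the slice at
        \<open>x t\<close> that occurs in \<open>dy\<close>.\<close>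
      have "gradient (\<lambda>v. S (xs, v)) (y t) = 0"
        using gradient_eq[OF GDERIV_partial_snd[OF G]] GDERIV_global_max[OF GDERIV_partial_snd[OF G]]
          saddle(1) zero[OF \<open>t \<ge> 0\<close>]
        by simp
      then show ?thesis
        using dy const \<open>t \<ge> 0\<close> has_vector_derivative_zero_of_constant[of "{0..}" x xs t] by auto
    next
      case 2
      \<comment> \<open>Strict concavity unfolds to strict convexity of the negated slice, so the
        maximisers \<open>ys\<close> and \<open>y s\<close> become minimisers.\<close>
      have const: "y s = ys" if "s \<ge> 0" for s
        using strictly_convex_on_min_unique[OF 2[of xs, unfolded strictly_concave_on_def], of ys "y s"]
          saddle(1) zero[OF that]
        by auto
      have "gradient (\<lambda>u. S (u, ys)) (x t) = 0"
        using gradient_eq[OF GDERIV_partial_fst[OF G]] GDERIV_global_min[OF GDERIV_partial_fst[OF G]]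
          saddle(2) zero[OF \<open>t \<ge> 0\<close>]
        by simp
      then show ?thesis
        using dx const \<open>t \<ge> 0\<close> has_vector_derivative_zero_of_constant[of "{0..}" y ys t] by auto
    qed
  qed
  have bounds: "(0 :: real ^ 2) \<le> vector [S (xs, ys) - S (xs, y), S (x, ys) - S (xs, ys)]" for x y
    using saddle(1)[of y] saddle(2)[of x] by (simp add: less_eq_vec_def forall_2)
  show ?thesis
    unfolding observable_certificate_def prod.case
  proof (rule conjI)
    show "\<exists>xs' ys'. saddle_point S xs' ys' \<and>
        (\<forall>x y. vector [S (xs, ys) - S (xs, y), S (x, ys) - S (xs, ys)]
            \<le> (vector [S (xs', ys') - S (xs', y), S (x, ys') - S (xs', ys')] :: real ^ 2) \<and>
          (0 :: real ^ 2) \<le> vector [S (xs, ys) - S (xs, y), S (x, ys) - S (xs, ys)])"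
      \<comment> \<open>With the given saddle point itself as witness, the upper bound on the
        certificate is an equality.\<close>
      by (intro exI[of _ xs] exI[of _ ys] conjI allI assms(3) order_refl bounds)
  next
    show "\<forall>x y. saddle_flow_trajectory S x y \<longrightarrow>
        (\<forall>t\<ge>0. vector [S (xs, ys) - S (xs, y t), S (x t, ys) - S (xs, ys)] = (0 :: real ^ 2)) \<longrightarrow>
        (\<forall>t\<ge>0. (x has_vector_derivative 0) (at t within {0..}) \<and>
               (y has_vector_derivative 0) (at t within {0..}))"
    proof (intro allI impI)
      fix x y and t :: real
      assume flow: "saddle_flow_trajectory S x y" and "t \<ge> 0"
        and "\<forall>t\<ge>0. vector [S (xs, ys) - S (xs, y t), S (x t, ys) - S (xs, ys)] = (0 :: real ^ 2)"
      \<comment> \<open>The vector equation splits into two vanishing differences, each read as an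
        equality of values of \<open>S\<close>.\<close>
      then have "S (xs, y t) = S (xs, ys) \<and> S (x t, ys) = S (xs, ys)" if "t \<ge> 0" for t
        using that unfolding vector_2_eq_zero_iff eq_iff_diff_eq_0[symmetric] by metis
      with flow \<open>t \<ge> 0\<close> show "(x has_vector_derivative 0) (at t within {0..}) \<and>
          (y has_vector_derivative 0) (at t within {0..})"
        by (rule stationary)
    qed
  qed
qed

end
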